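(* Let $\Gamma$ be a connected graph with countably infinitely many vertices whose automorphism group $\mathrm{Aut}(\Gamma)$ acts primitively on $V\Gamma$, and suppose $\Gamma$ has infinite diameter. Then $\Gamma$ has distinguishing number $2$.
   Context: Graphs are simple (no loops or multiple edges). The distinguishing number of a group $G$ acting faithfully on a set $V$ is the least number of colors needed to color the elements of $V$ so that no non-identity element of $G$ preserves every color class setwise; the distinguishing number of a graph is that of its full automorphism group acting on its vertex set. A graph is primitive if its automorphism group acts transitively on the vertex set and the only automorphism-invariant equivalence relations on the vertex set are the trivial one (equality) and the universal one. The diameter of $\Gamma$ is $\sup\{d(\alpha,\beta):\alpha,\beta\in V\Gamma\}$, where $d$ is the graph distance. *)

theory Defs
  imports "HOL-Algebra.Group_Action" "HOL-Library.Extended_Nat" "HOL-Library.Countable_Set"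
begin

section \<open>Group actions\<close>

definition primitive_action ::
    "('g, 'm) monoid_scheme \<Rightarrow> 'a set \<Rightarrow> ('g \<Rightarrow> 'a \<Rightarrow> 'a) \<Rightarrow> bool" where
  "primitive_action G V \<phi> \<longleftrightarrow>
     transitive_action G V \<phi> \<and>
     (\<forall>R. equiv V R \<and> (\<forall>g\<in>carrier G. \<forall>(x, y)\<in>R. (\<phi> g x, \<phi> g y) \<in> R)
          \<longrightarrow> R = Id_on V \<or> R = V \<times> V)"

definition distinguishing_colouring ::
    "('g, 'm) monoid_scheme \<Rightarrow> 'a set \<Rightarrow> ('g \<Rightarrow> 'a \<Rightarrow> 'a) \<Rightarrow> nat \<Rightarrow> ('a \<Rightarrow> nat) \<Rightarrow> bool" where
  "distinguishing_colouring G V \<phi> k c \<longleftrightarrow>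
     c \<in> V \<rightarrow> {..<k} \<and>
     (\<forall>g\<in>carrier G. (\<forall>i<k. \<phi> g ` {v\<in>V. c v = i} = {v\<in>V. c v = i}) \<longrightarrow> g = \<one>\<^bsub>G\<^esub>)"

text \<open>The infimum of the empty set is \<open>\<infinity>\<close>, so the value is \<open>\<infinity>\<close> when no finite number of
  colours suffices; infinite cardinalities are not told apart. The notion is meant for
  faithful actions.\<close>

definition distinguishing_number ::
    "('g, 'm) monoid_scheme \<Rightarrow> 'a set \<Rightarrow> ('g \<Rightarrow> 'a \<Rightarrow> 'a) \<Rightarrow> enat" where
  "distinguishing_number G V \<phi> = Inf {enat k | k. \<exists>c. distinguishing_colouring G V \<phi> k c}"


section \<open>Simple graphs\<close>

text \<open>An undirected edge joining \<open>u\<close> and \<open>v\<close> is represented by the two pairs \<open>(u, v)\<close> and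
  \<open>(v, u)\<close>. Vertex sets may be infinite.\<close>

locale simple_graph =
  fixes V :: "'a set" and E :: "'a rel"
  assumes edges_in_verts: "E \<subseteq> V \<times> V"
    and sym_edges: "sym E"
    and loopfree: "irrefl E"

definition connected_graph :: "'a set \<Rightarrow> 'a rel \<Rightarrow> bool" where
  "connected_graph V E \<longleftrightarrow> (\<forall>u\<in>V. \<forall>v\<in>V. (u, v) \<in> E\<^sup>*)"

text \<open>\<open>(u, v) \<in> E ^^ n\<close> holds iff there is a walk of length \<open>n\<close> from \<open>u\<close> to \<open>v\<close>; a shortest
  walk is a path.\<close>

definition graph_dist :: "'a rel \<Rightarrow> 'a \<Rightarrow> 'a \<Rightarrow> enat" where
  "graph_dist E u v = Inf {enat n | n. (u, v) \<in> E ^^ n}"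

definition graph_diameter :: "'a set \<Rightarrow> 'a rel \<Rightarrow> enat" where
  "graph_diameter V E = (SUP u\<in>V. SUP v\<in>V. graph_dist E u v)"

definition Aut :: "'a set \<Rightarrow> 'a rel \<Rightarrow> ('a \<Rightarrow> 'a) monoid" where
  "Aut V E = (BijGroup V)
     \<lparr>carrier := {f \<in> Bij V. \<forall>u\<in>V. \<forall>v\<in>V. (f u, f v) \<in> E \<longleftrightarrow> (u, v) \<in> E}\<rparr>"

lemma Aut_subgroup: "subgroup (carrier (Aut V E)) (BijGroup V)"
proof -
  interpret B: group "BijGroup V" by (rule group_BijGroup)
  show ?thesis
  proof (rule B.subgroupI)
    show "carrier (Aut V E) \<subseteq> carrier (BijGroup V)"
      by (auto simp: Aut_def BijGroup_def)
    show "carrier (Aut V E) \<noteq> {}"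
      using id_Bij[of V] by (force simp: Aut_def)
  next
    fix f assume f: "f \<in> carrier (Aut V E)"
    then have fB: "f \<in> Bij V" by (simp add: Aut_def)
    let ?g = "\<lambda>x\<in>V. inv_into V f x"
    have gB: "?g \<in> Bij V" by (rule restrict_inv_into_Bij[OF fB])
    have "(?g u, ?g v) \<in> E \<longleftrightarrow> (u, v) \<in> E" if uv: "u \<in> V" "v \<in> V" for u v
    proof -
      have "f ` V = V" using fB by (simp add: Bij_def bij_betw_def)
      then have "f (inv_into V f u) = u" "f (inv_into V f v) = v"
        using uv by (auto intro: f_inv_into_f)
      moreover have "(f (?g u), f (?g v)) \<in> E \<longleftrightarrow> (?g u, ?g v) \<in> E"
        using f uv Bij_inv_into_mem[OF fB] by (simp add: Aut_def)
      ultimately show ?thesis using uv by simp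
    qed
    then show "inv\<^bsub>BijGroup V\<^esub> f \<in> carrier (Aut V E)"
      using gB by (simp add: inv_BijGroup[OF fB] Aut_def)
  next
    fix f g assume "f \<in> carrier (Aut V E)" "g \<in> carrier (Aut V E)"
    then show "f \<otimes>\<^bsub>BijGroup V\<^esub> g \<in> carrier (Aut V E)"
      using Bij_imp_funcset[of g V]
      by (auto simp: Aut_def BijGroup_def compose_Bij compose_eq Pi_iff)
  qed
qed

lemma Aut_faithful_action: "faithful_action (Aut V E) V (\<lambda>f. f)"
proof -
  interpret B: group "BijGroup V" by (rule group_BijGroup)
  have A: "Aut V E = (BijGroup V)\<lparr>carrier := carrier (Aut V E)\<rparr>"
    by (simp add: Aut_def)
  have "group (Aut V E)"
    using B.subgroup_imp_group[OF Aut_subgroup] A by metis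
  moreover have "(\<lambda>f. f) \<in> hom (Aut V E) (BijGroup V)"
    by (auto simp: hom_def Aut_def BijGroup_def)
  ultimately show ?thesis
    by (simp add: faithful_action_def faithful_action_axioms_def group_action_def
        group_hom_def group_hom_axioms_def group_BijGroup)
qed

definition primitive_graph :: "'a set \<Rightarrow> 'a rel \<Rightarrow> bool" where
  "primitive_graph V E \<longleftrightarrow> primitive_action (Aut V E) V (\<lambda>f. f)"

definition graph_distinguishing_number :: "'a set \<Rightarrow> 'a rel \<Rightarrow> enat" where
  "graph_distinguishing_number V E = distinguishing_number (Aut V E) V (\<lambda>f. f)"

end

(* For fixed N, the relation "the spheres of radius at least N around x and y agree" is an
   invariant equivalence relation. It is not universal because the diameter is infinite, so by
   primitivity distinct vertices have distinct spheres of arbitrarily large radius. Fix a vertex a.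
   For each pair of distinct vertices colour one vertex that lies at different distances from
   the two, choosing these vertices at rapidly growing distances from a. Then each of them is
   the only coloured vertex on its sphere around a, so a colour-preserving automorphism that
   fixes a fixes all of them and hence cannot map one vertex of a pair to the other. Finally, a
   itself is made recognisable by colouring a and the vertices at distance 1 and 3 on
   a geodesic from a. *)
theory Submission
  imports Defs
begin

section \<open>A rigid subset for an integer-valued distance\<close>

text \<open>Rigidity comes from a gap in the distances: \<open>a\<close>, \<open>p\<close>,
  \<open>q\<close> are within 3 of each other, while every other point of \<open>W\<close> is at
  distance at least 4 from the rest of \<open>W\<close>. The argument is purely metric; graphs enter
  only later, through \<open>d\<close>.\<close>

lemma rigid_subset_of_distance:
  fixes d :: "'a \<Rightarrow> 'a \<Rightarrow> nat"
  assumes countable: "countable V"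
    and refl: "\<And>x. x \<in> V \<Longrightarrow> d x x = 0"
    and sym: "\<And>x y. x \<in> V \<Longrightarrow> y \<in> V \<Longrightarrow> d x y = d y x"
    and triangle: "\<And>x y z. x \<in> V \<Longrightarrow> y \<in> V \<Longrightarrow> z \<in> V \<Longrightarrow> d x z \<le> d x y + d y z"
    and V: "a \<in> V" "p \<in> V" "q \<in> V"
    and geodesic: "d a p = 1" "d p q = 2" "d a q = 3"
    and separated: "\<And>x y M. x \<in> V \<Longrightarrow> y \<in> V \<Longrightarrow> x \<noteq> y \<Longrightarrow>
      \<exists>z\<in>V. d x z \<noteq> d y z \<and> M \<le> d a z"
  obtains W where "W \<subseteq> V"
    "\<And>g. \<lbrakk>g \<in> V \<rightarrow> V; \<forall>x\<in>V. \<forall>y\<in>V. d (g x) (g y) = d x y; g ` W \<subseteq> W\<rbrakk>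
      \<Longrightarrow> \<forall>x\<in>V. g x = x"
proof -
  define P where "P = {(x, y) \<in> V \<times> V. x \<noteq> y}"
  have "a \<noteq> p" using geodesic refl V by auto
  then have "P \<noteq> {}" using V by (auto simp: P_def)
  have "countable P"
    unfolding P_def by (rule countable_subset[of _ "V \<times> V"]) (auto simp: countable)
  \<comment> \<open>If \<open>P\<close> is finite, \<open>pr\<close> repeats pairs; each occurrence
    then gets a separating vertex of its own.\<close>
  define pr where "pr = from_nat_into P"
  have range_pr: "range pr = P"
    unfolding pr_def using \<open>P \<noteq> {}\<close> \<open>countable P\<close> by (rule range_from_nat_into)
  have sep: "\<exists>z\<in>V. d (fst (pr n)) z \<noteq> d (snd (pr n)) z \<and> M \<le> d a z" for n M
    using rangeI[of pr n] unfolding range_pr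
    by (intro separated) (auto simp: P_def)
  \<comment> \<open>The bound 7 is 3 + 4: since \<open>a\<close>, \<open>p\<close>, \<open>q\<close>
    lie within 3 of \<open>a\<close>, the triangle inequality keeps \<open>f n\<close> at distance
    at least 4 from them. The increment 4 does the same for any two separating vertices.\<close>
  have "\<exists>f. \<forall>n. (f n \<in> V \<and> d (fst (pr n)) (f n) \<noteq> d (snd (pr n)) (f n) \<and> 7 \<le> d a (f n)) \<and>
      d a (f n) + 4 \<le> d a (f (Suc n))"
  proof (rule dependent_nat_choice)
    show "\<exists>z. z \<in> V \<and> d (fst (pr 0)) z \<noteq> d (snd (pr 0)) z \<and> 7 \<le> d a z"
      using sep[of 0 7] by blast
  next
    fix x n
    show "\<exists>z. (z \<in> V \<and> d (fst (pr (Suc n))) z \<noteq> d (snd (pr (Suc n))) z \<and> 7 \<le> d a z) \<and>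
        d a x + 4 \<le> d a z"
      using sep[of "Suc n" "d a x + 7"] by force
  qed
  then obtain f where fV: "\<And>n. f n \<in> V"
    and fsep: "\<And>n. d (fst (pr n)) (f n) \<noteq> d (snd (pr n)) (f n)"
    and f7: "\<And>n. 7 \<le> d a (f n)"
    and fstep: "\<And>n. d a (f n) + 4 \<le> d a (f (Suc n))"
    by auto
  have gap: "d a (f m) + 4 \<le> d a (f n)" if "m < n" for m n
    using that
  proof (induction n)
    case (Suc n)
    then show ?case using fstep[of n] by (cases "m = n") auto
  qed simp
  define W where "W = {a, p, q} \<union> range f"
  have WV: "W \<subseteq> V" using V fV by (auto simp: W_def)
  have far: "4 \<le> d (f n) w" if "w \<in> W" "w \<noteq> f n" for n w
  proof -
    have w: "w \<in> V" using WV that by blast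
    have *: "d a (f n) \<le> d a w + d (f n) w" "d a w \<le> d a (f n) + d (f n) w"
      using triangle[of a w "f n"] triangle[of a "f n" w] sym[of w "f n"] w V fV by auto
    from that(1) consider "w \<in> {a, p, q}" | m where "w = f m" by (auto simp: W_def)
    then show ?thesis
    proof cases
      case 1
      then have "d a w \<le> 3" using geodesic refl V by auto
      then show ?thesis using * f7[of n] by simp
    next
      case 2
      with that(2) have "m < n \<or> n < m" using nat_neq_iff by blast
      then show ?thesis using * gap[of m n] gap[of n m] 2 by auto
    qed
  qed
  show thesis
  proof (rule that[OF WV])
    fix g assume g: "g \<in> V \<rightarrow> V" and "\<forall>x\<in>V. \<forall>y\<in>V. d (g x) (g y) = d x y"
      and gW: "g ` W \<subseteq> W"
    then have iso: "d (g x) (g y) = d x y" if "x \<in> V" "y \<in> V" for x y using that by blast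
    \<comment> \<open>Within \<open>W\<close>, only \<open>a\<close> has points at distance 1 and at
      distance 3: each \<open>f n\<close> has nothing within 3, \<open>p\<close> sees the others of
      the triple at distances 1 and 2, and \<open>q\<close> sees them at 2 and 3. The images
      \<open>g p\<close> and \<open>g q\<close> are such points for \<open>g a\<close>.\<close>
    have ga: "g a = a"
    proof -
      have mem: "g a \<in> W" "g p \<in> W" "g q \<in> W" using gW by (auto simp: W_def)
      have dist: "d (g a) (g p) = 1" "d (g a) (g q) = 3" using iso V geodesic by auto
      have "g a \<noteq> f n" for n
        using far[of "g p" n] mem dist refl[of "f n"] fV[of n] by force
      moreover have "g a \<noteq> p"
      proof
        assume gp: "g a = p"
        have "g q \<noteq> f n" for n
        proof
          assume "g q = f n"
          then have "d (f n) p \<le> 3" using dist gp sym[of p "f n"] fV[of n] V by simp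
          moreover have "p \<noteq> f n" using f7[of n] geodesic by auto
          ultimately show False using far[of p n] by (simp add: W_def)
        qed
        then have "g q \<in> {a, p, q}" using mem(3) by (auto simp: W_def)
        then show False
          using dist gp geodesic refl[of p] V sym[of p a] by auto
      qed
      moreover have "g a \<noteq> q"
      proof
        assume gq: "g a = q"
        have "g p \<noteq> f n" for n
        proof
          assume "g p = f n"
          then have "d (f n) q \<le> 3" using dist gq sym[of q "f n"] fV[of n] V by simp
          moreover have "q \<noteq> f n" using f7[of n] geodesic by auto
          ultimately show False using far[of q n] by (simp add: W_def)
        qed
        then have "g p \<in> {a, p, q}" using mem(2) by (auto simp: W_def)
        then show False
          using dist gq geodesic refl[of q] V sym[of q a] sym[of q p] by auto
      qed
      ultimately show ?thesis using mem(1) by (auto simp: W_def)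
    qed
    \<comment> \<open>Once \<open>a\<close> is fixed, distance from \<open>a\<close> is preserved.
      It exceeds 3 on all \<open>f n\<close> and strictly increases with \<open>n\<close>, so it
      identifies \<open>f n\<close> within \<open>W\<close>.\<close>
    have gf: "g (f n) = f n" for n
    proof -
      have dn: "d a (g (f n)) = d a (f n)" using iso[of a "f n"] ga V fV by simp
      have "g (f n) \<in> W" using gW by (auto simp: W_def)
      moreover have "g (f n) \<notin> {a, p, q}"
        using dn f7[of n] geodesic refl[of a] V by auto
      ultimately obtain m where m: "g (f n) = f m" by (auto simp: W_def)
      with dn gap[of m n] gap[of n m] have "\<not> m < n" "\<not> n < m" by auto
      then have "m = n" by simp
      with m show ?thesis by simp
    qed
    show "\<forall>x\<in>V. g x = x"
    proof (rule ballI, rule ccontr)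
      fix x assume x: "x \<in> V" "g x \<noteq> x"
      \<comment> \<open>The pair consisting of a moved point and its image was itself assigned a
        separating vertex \<open>f n\<close>, which \<open>g\<close> fixes.\<close>
      then have "(x, g x) \<in> range pr" using g by (auto simp: range_pr P_def)
      then obtain n where "pr n = (x, g x)" by (metis imageE)
      moreover have "d (g x) (f n) = d x (f n)" using iso[of x "f n"] gf x fV by simp
      ultimately show False using fsep[of n] by simp
    qed
  qed
qed

section \<open>Walk distance and its invariance under automorphisms\<close>

text \<open>The value is junk for unconnected vertices, unlike that of \<^const>\<open>graph_dist\<close>.\<close>

definition walk_dist :: "'a rel \<Rightarrow> 'a \<Rightarrow> 'a \<Rightarrow> nat" where
  "walk_dist E u v = (LEAST n. (u, v) \<in> E ^^ n)"

lemma walk_dist_le: "(u, v) \<in> E ^^ n \<Longrightarrow> walk_dist E u v \<le> n"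
  unfolding walk_dist_def by (rule Least_le)

lemma walk_dist_refl: "walk_dist E u u = 0"
  using walk_dist_le[of u u 0 E] by simp

lemma walk_dist_walk: "(u, v) \<in> E\<^sup>* \<Longrightarrow> (u, v) \<in> E ^^ walk_dist E u v"
  unfolding walk_dist_def by (rule LeastI_ex) (simp add: rtrancl_power)

lemma walk_dist_triangle:
  assumes "(u, v) \<in> E\<^sup>*" "(v, w) \<in> E\<^sup>*"
  shows "walk_dist E u w \<le> walk_dist E u v + walk_dist E v w"
  using assms[THEN walk_dist_walk] by (intro walk_dist_le) (auto simp: relpow_add)

lemma sym_relpow: "sym E \<Longrightarrow> sym (E ^^ n)"
proof (induction n)
  case (Suc n)
  then show ?case
    using relpow_commute[of E n] by (auto simp: sym_conv_converse_eq converse_relcomp)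
qed (simp add: sym_Id)

lemma walk_dist_sym: "sym E \<Longrightarrow> walk_dist E u v = walk_dist E v u"
  unfolding walk_dist_def by (metis sym_relpow symD)

text \<open>Translates the infinite diameter into unboundedness of a distance with values in
  \<open>nat\<close>.\<close>

lemma graph_dist_eq_walk_dist:
  assumes "(u, v) \<in> E\<^sup>*"
  shows "graph_dist E u v = enat (walk_dist E u v)"
  unfolding graph_dist_def
proof (rule antisym)
  show "Inf {enat n |n. (u, v) \<in> E ^^ n} \<le> enat (walk_dist E u v)"
    using walk_dist_walk[OF assms] by (intro Inf_lower) auto
  show "enat (walk_dist E u v) \<le> Inf {enat n |n. (u, v) \<in> E ^^ n}"
    by (rule Inf_greatest) (auto intro: walk_dist_le)
qed

text \<open>Cut a shortest walk after \<open>m\<close> steps. The two pieces bound the distances by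
  \<open>m\<close> and \<open>n\<close>, and the triangle inequality forces equality in
  both.\<close>

lemma walk_dist_split:
  assumes "(u, v) \<in> E\<^sup>*" "walk_dist E u v = m + n"
  obtains w where "(u, w) \<in> E\<^sup>*" "(w, v) \<in> E\<^sup>*" "walk_dist E u w = m" "walk_dist E w v = n"
proof -
  obtain w where w: "(u, w) \<in> E ^^ m" "(w, v) \<in> E ^^ n"
    using walk_dist_walk[OF assms(1)] assms(2) by (auto simp: relpow_add)
  then have star: "(u, w) \<in> E\<^sup>*" "(w, v) \<in> E\<^sup>*" by (auto intro: relpow_imp_rtrancl)
  have "walk_dist E u w = m \<and> walk_dist E w v = n"
    using walk_dist_triangle[OF star] walk_dist_le[OF w(1)] walk_dist_le[OF w(2)] assms(2) by linarith
  with star that show thesis by blast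
qed

lemma relpow_mapI:
  assumes "\<And>x y. (x, y) \<in> E \<Longrightarrow> (f x, f y) \<in> F" "(u, v) \<in> E ^^ n"
  shows "(f u, f v) \<in> F ^^ n"
  using assms(2)
proof (induction n arbitrary: v)
  case (Suc n)
  then show ?case using assms(1) by auto
qed simp

lemma walk_dist_Aut:
  assumes E: "E \<subseteq> V \<times> V" and conn: "connected_graph V E"
    and f: "f \<in> carrier (Aut V E)" and uv: "u \<in> V" "v \<in> V"
  shows "walk_dist E (f u) (f v) = walk_dist E u v"
proof (rule antisym)
  have bij: "bij_betw f V V" and hom: "\<And>x y. x \<in> V \<Longrightarrow> y \<in> V \<Longrightarrow> (f x, f y) \<in> E \<longleftrightarrow> (x, y) \<in> E"
    using f by (auto simp: Aut_def Bij_def)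
  have fV: "f u \<in> V" "f v \<in> V" using bij uv by (auto simp: bij_betw_def)
  have walk: "(x, y) \<in> E ^^ walk_dist E x y" if "x \<in> V" "y \<in> V" for x y
    using conn that by (intro walk_dist_walk) (auto simp: connected_graph_def)
  have "\<And>x y. (x, y) \<in> E \<Longrightarrow> (f x, f y) \<in> E" using E hom by blast
  then show "walk_dist E (f u) (f v) \<le> walk_dist E u v"
    by (intro walk_dist_le relpow_mapI[OF _ walk]) (auto simp: uv)
  \<comment> \<open>The reverse inequality maps a shortest walk between the images back along the
    inverse.\<close>
  let ?g = "inv_into V f"
  have "(?g x, ?g y) \<in> E" if "(x, y) \<in> E" for x y
  proof -
    have "x \<in> f ` V" "y \<in> f ` V" using E that bij by (auto simp: bij_betw_def)
    then show ?thesis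
      using hom[of "?g x" "?g y"] that by (simp add: inv_into_into f_inv_into_f)
  qed
  then have "(?g (f u), ?g (f v)) \<in> E ^^ walk_dist E (f u) (f v)"
    by (rule relpow_mapI[OF _ walk[OF fV]])
  then show "walk_dist E u v \<le> walk_dist E (f u) (f v)"
    using bij uv by (intro walk_dist_le) (simp add: bij_betw_inv_into_left)
qed

section \<open>Separating vertices from primitivity\<close>

lemma primitive_actionD:
  assumes "primitive_action G V \<phi>" "equiv V R"
    and "\<And>g x y. g \<in> carrier G \<Longrightarrow> (x, y) \<in> R \<Longrightarrow> (\<phi> g x, \<phi> g y) \<in> R"
  shows "R = Id_on V \<or> R = V \<times> V"
  using assms unfolding primitive_action_def by blast

lemma primitive_graph_spheres:
  assumes E: "E \<subseteq> V \<times> V" and conn: "connected_graph V E"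
    and prim: "primitive_graph V E"
    and unbounded: "\<And>n. \<exists>u\<in>V. \<exists>v\<in>V. n < walk_dist E u v"
    and "x \<in> V" "y \<in> V" "x \<noteq> y"
  obtains z where "z \<in> V" "walk_dist E x z \<noteq> walk_dist E y z"
    "N \<le> walk_dist E x z \<or> N \<le> walk_dist E y z"
proof -
  \<comment> \<open>\<open>max N\<close> forgets exactly the spheres of radius less than \<open>N\<close>.\<close>
  define R where "R = {(x, y) \<in> V \<times> V. \<forall>z\<in>V. max N (walk_dist E x z) = max N (walk_dist E y z)}"
  have "equiv V R"
    by (rule equivI) (auto simp: R_def refl_on_def sym_def trans_def)
  moreover have "(g x, g y) \<in> R" if g: "g \<in> carrier (Aut V E)" and xy: "(x, y) \<in> R" for g x y
  proof -
    have "bij_betw g V V" using g by (auto simp: Aut_def Bij_def)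
    then have im: "g ` V = V" by (simp add: bij_betw_def)
    have "max N (walk_dist E (g x) (g z)) = max N (walk_dist E (g y) (g z))" if "z \<in> V" for z
      using xy that walk_dist_Aut[OF E conn g] by (auto simp: R_def)
    \<comment> \<open>Surjectivity of \<open>g\<close> turns a statement about the vertices
      \<open>g z\<close> into one about all vertices.\<close>
    then have "\<forall>z\<in>g ` V. max N (walk_dist E (g x) z) = max N (walk_dist E (g y) z)" by blast
    then show ?thesis using xy im by (auto simp: R_def)
  qed
  ultimately have "R = Id_on V \<or> R = V \<times> V"
    using prim unfolding primitive_graph_def by (intro primitive_actionD)
  moreover have "R \<noteq> V \<times> V"
  proof
    assume R: "R = V \<times> V"
    obtain u v where uv: "u \<in> V" "v \<in> V" "N < walk_dist E u v" using unbounded by blast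
    then have "(u, v) \<in> R" by (simp add: R)
    \<comment> \<open>Testing with \<open>z = v\<close> compares a distance greater than
      \<open>N\<close> with 0.\<close>
    then have "max N (walk_dist E u v) = max N (walk_dist E v v)" using uv by (auto simp: R_def)
    then show False using uv by (simp add: walk_dist_refl)
  qed
  ultimately have "(x, y) \<notin> R" using \<open>x \<noteq> y\<close> by auto
  then obtain z where z: "z \<in> V" "max N (walk_dist E x z) \<noteq> max N (walk_dist E y z)"
    using \<open>x \<in> V\<close> \<open>y \<in> V\<close> by (auto simp: R_def)
  then have "walk_dist E x z \<noteq> walk_dist E y z \<and> (N \<le> walk_dist E x z \<or> N \<le> walk_dist E y z)"
    by (auto simp: max_def split: if_splits)
  with z that show thesis by blast
qed

section \<open>Two-colourings and the distinguishing number\<close>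

text \<open>A nonempty set has no colouring with 0 colours. With 1 colour the only class is
  \<open>V\<close>, which the non-identity element \<open>g\<close> preserves.\<close>

lemma distinguishing_number_eq_2:
  assumes "distinguishing_colouring G V \<phi> 2 c"
    and "V \<noteq> {}"
    and "g \<in> carrier G" "\<phi> g ` V = V" "g \<noteq> \<one>\<^bsub>G\<^esub>"
  shows "distinguishing_number G V \<phi> = 2"
  unfolding distinguishing_number_def
proof (rule antisym)
  show "Inf {enat k |k. \<exists>c. distinguishing_colouring G V \<phi> k c} \<le> 2"
    using assms(1) by (intro Inf_lower) (auto simp: numeral_eq_enat)
  have "2 \<le> k" if col: "distinguishing_colouring G V \<phi> k c" for k c
  proof (rule ccontr)
    assume "\<not> 2 \<le> k"
    then have "k = 0 \<or> k = 1" by auto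
    then show False
    proof
      assume "k = 0"
      then show False using col assms(2) by (auto simp: distinguishing_colouring_def)
    next
      assume k: "k = 1"
      then have "{v \<in> V. c v = 0} = V" using col by (auto simp: distinguishing_colouring_def)
      then show False using col assms(3-5) k by (auto simp: distinguishing_colouring_def)
    qed
  qed
  then show "2 \<le> Inf {enat k |k. \<exists>c. distinguishing_colouring G V \<phi> k c}"
    by (intro Inf_greatest) (auto simp: numeral_eq_enat)
qed

lemma distinguishing_colouring_AutI:
  assumes "W \<subseteq> V"
    and rigid: "\<And>g. g \<in> carrier (Aut V E) \<Longrightarrow> g ` W \<subseteq> W \<Longrightarrow> \<forall>x\<in>V. g x = x"
  shows "distinguishing_colouring (Aut V E) V (\<lambda>f. f) 2 (\<lambda>x. if x \<in> W then 1 else 0)"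
  unfolding distinguishing_colouring_def
proof (intro conjI ballI impI)
  fix g assume g: "g \<in> carrier (Aut V E)"
    and pres: "\<forall>i<2::nat. g ` {v \<in> V. (if v \<in> W then 1 else 0) = i} = {v \<in> V. (if v \<in> W then 1 else 0) = i}"
  have "g ` {v \<in> V. (if v \<in> W then 1 else 0 :: nat) = 1} = {v \<in> V. (if v \<in> W then 1 else 0 :: nat) = 1}"
    using pres[rule_format, of 1] by simp
  moreover have "{v \<in> V. (if v \<in> W then 1 else 0 :: nat) = 1} = W" using assms(1) by auto
  ultimately have "\<forall>x\<in>V. g x = x" using rigid[OF g] by simp
  \<comment> \<open>Automorphisms take the value \<open>undefined\<close> outside \<open>V\<close>,
    so agreement with the identity on \<open>V\<close> makes \<open>g\<close> the unit of the
    group.\<close>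
  moreover have "g \<in> extensional V" using g by (auto simp: Aut_def Bij_def)
  ultimately have "g = (\<lambda>x\<in>V. x)" by (auto simp: extensional_def)
  then show "g = \<one>\<^bsub>Aut V E\<^esub>" by (simp add: Aut_def BijGroup_def)
qed auto

theorem theorem1:
  fixes V :: "'a set" and E :: "'a rel"
  assumes "simple_graph V E"
    and "connected_graph V E"
    and "countable V" and "infinite V"
    and "primitive_graph V E"
    and "graph_diameter V E = \<infinity>"
  shows "graph_distinguishing_number V E = 2"
proof -
  interpret simple_graph V E by fact
  let ?d = "walk_dist E"
  have conn: "(u, v) \<in> E\<^sup>*" if "u \<in> V" "v \<in> V" for u v
    using assms(2) that by (simp add: connected_graph_def)
  have unbounded: "\<exists>u\<in>V. \<exists>v\<in>V. n < ?d u v" for n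
  proof (rule ccontr)
    assume "\<not> ?thesis"
    then have "graph_dist E u v \<le> enat n" if "u \<in> V" "v \<in> V" for u v
      using that by (simp add: graph_dist_eq_walk_dist conn not_less)
    then have "graph_diameter V E \<le> enat n"
      unfolding graph_diameter_def by (intro SUP_least)
    then show False using assms(6) by simp
  qed
  have triangle: "?d u w \<le> ?d u v + ?d v w" if "u \<in> V" "v \<in> V" "w \<in> V" for u v w
    using that by (intro walk_dist_triangle conn)
  \<comment> \<open>The vertex \<open>u\<close> serves as \<open>a\<close>. Cutting a geodesic from
    \<open>u\<close> at distance 3 gives \<open>q\<close>, and cutting again at distance 1 gives
    \<open>p\<close>.\<close>
  obtain u v where uv: "u \<in> V" "v \<in> V" "3 < ?d u v" using unbounded by blast
  then have "?d u v = 3 + (?d u v - 3)" by simp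
  then obtain q where q: "(u, q) \<in> E\<^sup>*" "?d u q = 3"
    by (rule walk_dist_split[OF conn[OF uv(1,2)]])
  then have "?d u q = 1 + 2" by simp
  then obtain p where p: "(u, p) \<in> E\<^sup>*" "?d u p = 1" "?d p q = 2"
    by (rule walk_dist_split[OF q(1)])
  have in_V: "y \<in> V" if "(u, y) \<in> E\<^sup>*" for y
    using that uv(1) edges_in_verts by (cases rule: rtranclE) auto
  have separated: "\<exists>z\<in>V. ?d x z \<noteq> ?d y z \<and> M \<le> ?d u z" if xy: "x \<in> V" "y \<in> V" "x \<noteq> y" for x y M
  proof -
    \<comment> \<open>Spheres around \<open>x\<close> and \<open>y\<close> must be traded for
      distance from \<open>u\<close>. The terms \<open>?d x u\<close> and \<open>?d y u\<close> in
      the radius absorb the loss in the triangle inequality, whichever of the two distances is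
      large.\<close>
    obtain z where z: "z \<in> V" "?d x z \<noteq> ?d y z"
      "M + ?d x u + ?d y u \<le> ?d x z \<or> M + ?d x u + ?d y u \<le> ?d y z"
      using primitive_graph_spheres[OF edges_in_verts assms(2,5) unbounded xy] by metis
    moreover have "?d x z \<le> ?d x u + ?d u z" "?d y z \<le> ?d y u + ?d u z"
      using z xy uv by (auto intro: triangle)
    ultimately have "M \<le> ?d u z" by linarith
    with z show ?thesis by blast
  qed
  obtain W where W: "W \<subseteq> V"
    "\<And>g. \<lbrakk>g \<in> V \<rightarrow> V; \<forall>x\<in>V. \<forall>y\<in>V. ?d (g x) (g y) = ?d x y; g ` W \<subseteq> W\<rbrakk>
      \<Longrightarrow> \<forall>x\<in>V. g x = x"
    by (rule rigid_subset_of_distance[OF assms(3) walk_dist_refl walk_dist_sym[OF sym_edges]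
          triangle uv(1) in_V[OF p(1)] in_V[OF q(1)] p(2,3) q(2) separated]) blast+
  have col: "distinguishing_colouring (Aut V E) V (\<lambda>f. f) 2 (\<lambda>x. if x \<in> W then 1 else 0)"
  proof (rule distinguishing_colouring_AutI[OF W(1)])
    fix g assume g: "g \<in> carrier (Aut V E)" "g ` W \<subseteq> W"
    then have "g \<in> V \<rightarrow> V" by (auto simp: Aut_def Bij_def bij_betw_def)
    then show "\<forall>x\<in>V. g x = x"
      using walk_dist_Aut[OF edges_in_verts assms(2) g(1)] g(2) by (intro W(2)) auto
  qed
  have "u \<noteq> p" using p by (auto simp: walk_dist_refl)
  \<comment> \<open>Transitivity supplies an automorphism moving \<open>u\<close> to
    \<open>p\<close>, hence a non-identity one, which rules out a single colour.\<close>
  have "transitive_action (Aut V E) V (\<lambda>f. f)"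
    using assms(5) by (simp add: primitive_graph_def primitive_action_def)
  then obtain g where g: "g \<in> carrier (Aut V E)" "g u = p"
    using transitive_action.unique_orbit uv(1) in_V[OF p(1)] by metis
  then have "g ` V = V" by (auto simp: Aut_def Bij_def bij_betw_def)
  moreover have "g \<noteq> \<one>\<^bsub>Aut V E\<^esub>"
    using g(2) \<open>u \<noteq> p\<close> uv(1) by (auto simp: Aut_def BijGroup_def)
  ultimately show ?thesis
    unfolding graph_distinguishing_number_def
    using col g(1) uv(1) by (intro distinguishing_number_eq_2[where g = g]) auto
qed

end
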